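(* Let $(a_1,\ldots,a_n)\in\mathbb{H}^n$ and let $k$, with $1\le k\le n$, be such that $a_l\notin\mathbb{R}$ for every $1\le l\le k$, and $a_la_m=a_ma_l$ for any $l,m>k$. Then $E_{\mathbb{S}_{a_1}\times\cdots\times\mathbb{S}_{a_k}\times\{a_{k+1}\}\times\cdots\times\{a_n\}}$ is a right ideal (of $\mathbb{H}[q_1,\ldots,q_n]$) contained in $E_{(a_1,\ldots,a_n)}$.
   Context: $\mathbb{H}$ is the skew field of quaternions. A slice regular polynomial in $n$ variables is a function $P:\mathbb{H}^n\to\mathbb{H}$ of the form $P(q_1,\ldots,q_n)=\sum_{\ell} q_1^{\ell_1}\cdots q_n^{\ell_n}a_{\ell_1,\ldots,\ell_n}$ (finite sum over multi-indices, variables in this fixed order, coefficients in $\mathbb{H}$ on the right). $\mathbb{H}[q_1,\ldots,q_n]$ is the set of these; it is a (non-commutative) ring under $+$ and the $*$-product, the biadditive extension of $(q_1^{\ell_1}\cdots q_n^{\ell_n}a)*(q_1^{m_1}\cdots q_n^{m_n}b)=q_1^{\ell_1+m_1}\cdots q_n^{\ell_n+m_n}ab$. Right ideals are taken with respect to this ring structure. For $U\subseteq\mathbb{H}^n$, $E_U$ is the set of $P\in\mathbb{H}[q_1,\ldots,q_n]$ vanishing at every point of $U$; $E_{(a_1,\ldots,a_n)}$ is $E_U$ for $U=\{(a_1,\ldots,a_n)\}$. For $a\in\mathbb{H}$, $\mathbb{S}_a=\{\mathrm{Re}(a)+J|\mathrm{Im}(a)| : J\in\mathbb{H},\ J^2=-1\}$,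 where $\mathrm{Im}(a)=a-\mathrm{Re}(a)$. *)

theory Defs
  imports "HOL-Analysis.Analysis" "HOL-Library.Poly_Mapping" "HOL-Algebra.Ideal"
begin

section \<open>Quaternions\<close>

datatype quat = Quat (qRe: real) (qIm1: real) (qIm2: real) (qIm3: real)

lemma quat_eq_iff:
  "x = y \<longleftrightarrow> qRe x = qRe y \<and> qIm1 x = qIm1 y \<and> qIm2 x = qIm2 y \<and> qIm3 x = qIm3 y"
  by (cases x; cases y) simp

instantiation quat :: real_vector
begin

definition "0 = Quat 0 0 0 0"
definition "x + y = Quat (qRe x + qRe y) (qIm1 x + qIm1 y) (qIm2 x + qIm2 y) (qIm3 x + qIm3 y)"
definition "- x = Quat (- qRe x) (- qIm1 x) (- qIm2 x) (- qIm3 x)"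
definition "x - y = Quat (qRe x - qRe y) (qIm1 x - qIm1 y) (qIm2 x - qIm2 y) (qIm3 x - qIm3 y)"
definition "r *\<^sub>R x = Quat (r * qRe x) (r * qIm1 x) (r * qIm2 x) (r * qIm3 x)"

instance
  by standard
    (simp_all add: zero_quat_def plus_quat_def uminus_quat_def minus_quat_def scaleR_quat_def
      quat_eq_iff algebra_simps)

end

lemmas quat_add_defs =
  zero_quat_def plus_quat_def uminus_quat_def minus_quat_def scaleR_quat_def

instantiation quat :: real_inner
begin

definition inner_quat :: "quat \<Rightarrow> quat \<Rightarrow> real"
  where "inner_quat x y = qRe x * qRe y + qIm1 x * qIm1 y + qIm2 x * qIm2 y + qIm3 x * qIm3 y"
definition norm_quat :: "quat \<Rightarrow> real"
  where "norm_quat x = sqrt (inner x x)"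
definition sgn_quat :: "quat \<Rightarrow> quat"
  where "sgn_quat x = x /\<^sub>R norm x"
definition dist_quat :: "quat \<Rightarrow> quat \<Rightarrow> real"
  where "dist_quat x y = norm (x - y)"
definition uniformity_quat :: "(quat \<times> quat) filter"
  where "uniformity_quat = (INF e\<in>{0<..}. principal {(x, y). dist x y < e})"
definition open_quat :: "quat set \<Rightarrow> bool"
  where "open_quat U \<longleftrightarrow> (\<forall>x\<in>U. eventually (\<lambda>(x', y). x' = x \<longrightarrow> y \<in> U) uniformity)"

instance
proof
  fix x y z :: quat and r :: real
  show "0 \<le> inner x x"
    by (simp add: inner_quat_def)
  show "inner x x = 0 \<longleftrightarrow> x = 0"
  proof -
    have "inner x x = 0 \<longleftrightarrow> (qRe x)\<^sup>2 + (qIm1 x)\<^sup>2 + (qIm2 x)\<^sup>2 + (qIm3 x)\<^sup>2 = 0"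
      by (simp add: inner_quat_def power2_eq_square)
    also have "\<dots> \<longleftrightarrow> x = 0"
      by (auto simp: quat_eq_iff zero_quat_def add_nonneg_eq_0_iff)
    finally show ?thesis .
  qed
qed (simp_all add: inner_quat_def norm_quat_def sgn_quat_def dist_quat_def uniformity_quat_def
      open_quat_def quat_add_defs algebra_simps)

end

text \<open>Hamilton's product, with basis \<open>1, i, j, k\<close> and \<open>i j = k\<close>; the inverse is the conjugate
  divided by the squared norm.\<close>

instantiation quat :: real_normed_div_algebra
begin

definition "1 = Quat 1 0 0 0"
definition "x * y = Quat
  (qRe x * qRe y - qIm1 x * qIm1 y - qIm2 x * qIm2 y - qIm3 x * qIm3 y)
  (qRe x * qIm1 y + qIm1 x * qRe y + qIm2 x * qIm3 y - qIm3 x * qIm2 y)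
  (qRe x * qIm2 y - qIm1 x * qIm3 y + qIm2 x * qRe y + qIm3 x * qIm1 y)
  (qRe x * qIm3 y + qIm1 x * qIm2 y - qIm2 x * qIm1 y + qIm3 x * qRe y)"
definition inverse_quat :: "quat \<Rightarrow> quat"
  where "inverse_quat x = Quat (qRe x) (- qIm1 x) (- qIm2 x) (- qIm3 x) /\<^sub>R (norm x)\<^sup>2"
definition divide_quat :: "quat \<Rightarrow> quat \<Rightarrow> quat"
  where "divide_quat x y = x * inverse y"

instance
proof
  fix x y :: quat
  show "norm (x * y) = norm x * norm y"
    unfolding norm_quat_def inner_quat_def times_quat_def real_sqrt_mult[symmetric]
    by (simp add: algebra_simps)
  assume "x \<noteq> 0"
  define u where "u = inverse ((norm x)\<^sup>2)"
  have "u * (norm x)\<^sup>2 = 1"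
    using \<open>x \<noteq> 0\<close> by (simp add: u_def)
  then have u: "u * (qRe x * qRe x + qIm1 x * qIm1 x + qIm2 x * qIm2 x + qIm3 x * qIm3 x) = 1"
    by (simp add: power2_norm_eq_inner inner_quat_def)
  show "inverse x * x = 1" "x * inverse x = 1"
    using u unfolding inverse_quat_def u_def[symmetric]
    by (simp_all add: quat_eq_iff times_quat_def one_quat_def scaleR_quat_def algebra_simps)
qed (simp_all add: times_quat_def one_quat_def quat_add_defs divide_quat_def quat_eq_iff
      algebra_simps inverse_quat_def)

end

definition quat_sphere :: "quat \<Rightarrow> quat set"
  where "quat_sphere a =
    {of_real (qRe a) + J * of_real (norm (a - of_real (qRe a))) | J. J * J = - 1}"


section \<open>Slice regular polynomials\<close>

text \<open>The index set \<open>{1,\<dots>,n}\<close> of the variables is a finite linearly ordered type \<^typ>\<open>'n\<close>;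
  its order fixes the order of the factors in a monomial, since \<^typ>\<open>quat\<close> is not commutative.
  A finite family of coefficients is an element of \<open>('n \<Rightarrow>\<^sub>0 nat) \<Rightarrow>\<^sub>0 quat\<close>.\<close>

definition ordered_monomial :: 
    "('n::{finite,linorder} \<Rightarrow>\<^sub>0 nat) \<Rightarrow> quat ^ 'n::{finite,linorder} \<Rightarrow> quat"
  where "ordered_monomial l q =
    prod_list (map (\<lambda>i. (q $ i) ^ Poly_Mapping.lookup l i) (sorted_list_of_set UNIV))"

definition slice_eval ::
    "(('n::{finite,linorder} \<Rightarrow>\<^sub>0 nat) \<Rightarrow>\<^sub>0 quat) \<Rightarrow> quat ^ 'n::{finite,linorder} \<Rightarrow> quat"
  where "slice_eval p q = (\<Sum>l\<in>Poly_Mapping.keys p. ordered_monomial l q * Poly_Mapping.lookup p l)"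

definition slice_polys :: "(quat ^ 'n::{finite,linorder} \<Rightarrow> quat) set"
  where "slice_polys = range slice_eval"

text \<open>A slice regular polynomial is a function; its coefficients are well defined by
  \<open>inj_slice_eval\<close> below. On coefficients, the product of
  \<^typ>\<open>('n \<Rightarrow>\<^sub>0 nat) \<Rightarrow>\<^sub>0 quat\<close> is the convolution product, in which
  coefficients commute with the variables; see \<open>star_monomial\<close>, \<open>star_add_left\<close> and
  \<open>star_add_right\<close> for the characterisation of the resulting product of functions.\<close>

definition slice_coeffs ::
    "(quat ^ 'n::{finite,linorder} \<Rightarrow> quat) \<Rightarrow> ('n::{finite,linorder} \<Rightarrow>\<^sub>0 nat) \<Rightarrow>\<^sub>0 quat"
  where "slice_coeffs = the_inv slice_eval"

definition star_prod ::
    "(quat ^ 'n::{finite,linorder} \<Rightarrow> quat) \<Rightarrow> (quat ^ 'n::{finite,linorder} \<Rightarrow> quat) \<Rightarrow>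
      quat ^ 'n::{finite,linorder} \<Rightarrow> quat"
  where "star_prod P Q = slice_eval (slice_coeffs P * slice_coeffs Q)"

definition slice_poly_ring :: "(quat ^ 'n::{finite,linorder} \<Rightarrow> quat) ring"
  where "slice_poly_ring =
    \<lparr>carrier = slice_polys, monoid.mult = star_prod, one = (\<lambda>q. 1),
     zero = (\<lambda>q. 0), add = (\<lambda>P Q q. P q + Q q)\<rparr>"

definition vanishing_set ::
    "(quat ^ 'n::{finite,linorder}) set \<Rightarrow> (quat ^ 'n::{finite,linorder} \<Rightarrow> quat) set"
  where "vanishing_set U = {P \<in> slice_polys. \<forall>q\<in>U. P q = 0}"

locale right_ideal = additive_subgroup I R + ring R for I and R (structure) +
  assumes I_r_closed: "\<lbrakk>x \<in> I; y \<in> carrier R\<rbrakk> \<Longrightarrow> x \<otimes> y \<in> I"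


section \<open>Well-definedness of the product\<close>

lemma slice_eval_superset:
  assumes "finite A" "Poly_Mapping.keys p \<subseteq> A"
  shows "slice_eval p q = (\<Sum>l\<in>A. ordered_monomial l q * Poly_Mapping.lookup p l)"
  unfolding slice_eval_def using assms
  by (intro sum.mono_neutral_left) (auto simp: in_keys_iff)

lemma slice_eval_add: "slice_eval (p + r) q = slice_eval p q + slice_eval r q"
proof -
  let ?A = "Poly_Mapping.keys p \<union> Poly_Mapping.keys r"
  have "Poly_Mapping.keys (p + r) \<subseteq> ?A" by (rule Poly_Mapping.keys_add)
  then show ?thesis
    by (simp add: slice_eval_superset[of ?A] lookup_add distrib_left sum.distrib)
qed

lemma slice_eval_0: "slice_eval 0 q = 0"
  by (simp add: slice_eval_def)

lemma slice_eval_uminus: "slice_eval (- p) q = - slice_eval p q"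
  by (metis add_eq_0_iff2 slice_eval_add slice_eval_0 ab_left_minus)

lemma slice_eval_single: "slice_eval (Poly_Mapping.single l c) q = ordered_monomial l q * c"
  by (simp add: slice_eval_def)

lemma slice_eval_1: "slice_eval 1 q = 1"
proof -
  have "ordered_monomial 0 q = 1"
    unfolding ordered_monomial_def by (simp add: map_replicate_const)
  then show ?thesis
    by (simp only: single_one[symmetric] slice_eval_single mult_1_left)
qed

lemma univariate_zero:
  fixes f :: "nat \<Rightarrow> quat"
  assumes D: "finite D" and z: "\<And>t::real. (\<Sum>d\<in>D. t ^ d *\<^sub>R f d) = 0" and d: "d \<in> D"
  shows "f d = 0"
proof (rule ccontr)
  assume nz: "f d \<noteq> 0"
  obtain n where n: "D \<subseteq> {..n}" using D finite_nat_iff_bounded_le by blast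
  define c where "c = (\<lambda>i. if i \<in> D then inner (f d) (f i) else 0)"
  have "\<forall>t. (\<Sum>i\<le>n. c i * t ^ i) = 0"
  proof
    fix t :: real
    have "(\<Sum>i\<le>n. c i * t ^ i) = (\<Sum>i\<in>D. c i * t ^ i)"
      by (rule sum.mono_neutral_right) (use n in \<open>auto simp: c_def\<close>)
    also have "\<dots> = inner (f d) (\<Sum>i\<in>D. t ^ i *\<^sub>R f i)"
      by (simp add: inner_sum_right c_def mult.commute)
    finally show "(\<Sum>i\<le>n. c i * t ^ i) = 0" using z by simp
  qed
  then have "\<forall>i\<le>n. c i = 0" using polyfun_eq_0 by blast
  with n d nz show False by (auto simp: c_def)
qed

lemma multivariate_zero:
  fixes f :: "('n \<Rightarrow>\<^sub>0 nat) \<Rightarrow> quat"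
  assumes "finite V" "finite K" "inj_on (\<lambda>l. restrict (Poly_Mapping.lookup l) V) K"
    and "\<And>x::'n \<Rightarrow> real. (\<Sum>l\<in>K. (\<Prod>i\<in>V. x i ^ Poly_Mapping.lookup l i) *\<^sub>R f l) = 0"
    and "l \<in> K"
  shows "f l = 0"
  using assms
proof (induction V arbitrary: K l rule: finite_induct)
  case empty
  then have "K = {l}" by (auto simp: inj_on_def)
  with empty.prems(3)[of "\<lambda>_. 0"] show ?case by simp
next
  case (insert v V)
  define Kd where "Kd = (\<lambda>d. {m \<in> K. Poly_Mapping.lookup m v = d})"
  define D where "D = (\<lambda>m. Poly_Mapping.lookup m v) ` K"
  show ?case
  proof (rule insert.IH[of "Kd (Poly_Mapping.lookup l v)"])
    show "finite (Kd (Poly_Mapping.lookup l v))" "l \<in> Kd (Poly_Mapping.lookup l v)"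
      using insert.prems by (auto simp: Kd_def)
    show "inj_on (\<lambda>l. restrict (Poly_Mapping.lookup l) V) (Kd (Poly_Mapping.lookup l v))"
    proof (rule inj_onI)
      fix m m' assume m: "m \<in> Kd (Poly_Mapping.lookup l v)" "m' \<in> Kd (Poly_Mapping.lookup l v)"
        and e: "restrict (Poly_Mapping.lookup m) V = restrict (Poly_Mapping.lookup m') V"
      have "restrict (Poly_Mapping.lookup m) (insert v V) = restrict (Poly_Mapping.lookup m') (insert v V)"
      proof
        fix i
        show "restrict (Poly_Mapping.lookup m) (insert v V) i = restrict (Poly_Mapping.lookup m') (insert v V) i"
          using m fun_cong[OF e, of i] by (auto simp: Kd_def restrict_def split: if_splits)
      qed
      moreover have "m \<in> K" "m' \<in> K" using m by (auto simp: Kd_def)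
      ultimately show "m = m'" by (rule inj_onD[OF insert.prems(2)])
    qed
    fix x :: "'n \<Rightarrow> real"
    define g where "g = (\<lambda>d. \<Sum>m\<in>Kd d. (\<Prod>i\<in>V. x i ^ Poly_Mapping.lookup m i) *\<^sub>R f m)"
    have "(\<Sum>d\<in>D. t ^ d *\<^sub>R g d) = 0" for t :: real
    proof -
      let ?y = "x(v := t)"
      have p: "(\<Prod>i\<in>insert v V. ?y i ^ Poly_Mapping.lookup m i) = t ^ Poly_Mapping.lookup m v * (\<Prod>i\<in>V. x i ^ Poly_Mapping.lookup m i)"
        for m
      proof -
        have "(\<Prod>i\<in>V. ?y i ^ Poly_Mapping.lookup m i) = (\<Prod>i\<in>V. x i ^ Poly_Mapping.lookup m i)"
          using insert.hyps(2) by (intro prod.cong) auto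
        then show ?thesis using insert.hyps by simp
      qed
      have "(\<Sum>d\<in>D. t ^ d *\<^sub>R g d) =
          (\<Sum>d\<in>D. \<Sum>m\<in>Kd d. (\<Prod>i\<in>insert v V. ?y i ^ Poly_Mapping.lookup m i) *\<^sub>R f m)"
        unfolding g_def scaleR_sum_right p by (intro sum.cong refl) (auto simp: Kd_def)
      also have "\<dots> = (\<Sum>m\<in>K. (\<Prod>i\<in>insert v V. ?y i ^ Poly_Mapping.lookup m i) *\<^sub>R f m)"
        unfolding Kd_def D_def using insert.prems(1) by (intro sum.group) auto
      finally show ?thesis using insert.prems(3) by simp
    qed
    moreover have "finite D" "Poly_Mapping.lookup l v \<in> D"
      using insert.prems by (auto simp: D_def)
    ultimately show "(\<Sum>m\<in>Kd (Poly_Mapping.lookup l v). (\<Prod>i\<in>V. x i ^ Poly_Mapping.lookup m i) *\<^sub>R f m) = 0"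
      using univariate_zero[of D g] by (simp add: g_def)
  qed
qed

lemma ordered_monomial_real:
  "ordered_monomial l (\<chi> i. of_real (x i)) = of_real (\<Prod>i\<in>UNIV. x i ^ Poly_Mapping.lookup l i)"
proof -
  have *: "prod_list (map (\<lambda>i. (of_real (x i) :: quat) ^ Poly_Mapping.lookup l i) is) =
      of_real (prod_list (map (\<lambda>i. x i ^ Poly_Mapping.lookup l i) is))" for "is"
    by (induction "is") simp_all
  show ?thesis
    unfolding ordered_monomial_def vec_lambda_beta *
    by (simp add: prod.distinct_set_conv_list[symmetric])
qed

lemma inj_slice_eval: "inj slice_eval"
proof (rule injI)
  fix p r :: "('n::{finite,linorder} \<Rightarrow>\<^sub>0 nat) \<Rightarrow>\<^sub>0 quat"
  assume e: "slice_eval p = slice_eval r"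
  have z: "slice_eval (p - r) q = 0" for q
    using slice_eval_add[of p "- r" q] by (simp add: slice_eval_uminus e)
  have "Poly_Mapping.lookup (p - r) l = 0" if "l \<in> Poly_Mapping.keys (p - r)" for l
  proof (rule multivariate_zero[of UNIV "Poly_Mapping.keys (p - r)"])
    show "inj_on (\<lambda>l. restrict (Poly_Mapping.lookup l) UNIV) (Poly_Mapping.keys (p - r))"
      by (simp add: inj_on_def restrict_UNIV lookup_inject)
    show "(\<Sum>l\<in>Poly_Mapping.keys (p - r).
        (\<Prod>i\<in>UNIV. x i ^ Poly_Mapping.lookup l i) *\<^sub>R Poly_Mapping.lookup (p - r) l) = 0" for x
      using z[of "\<chi> i. of_real (x i)"]
      by (simp add: slice_eval_def ordered_monomial_real scaleR_conv_of_real)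
  qed (use that in simp_all)
  then have "p - r = 0" by (metis in_keys_iff keys_eq_empty equals0I)
  then show "p = r" by simp
qed

lemma slice_coeffs_eval [simp]: "slice_coeffs (slice_eval p) = p"
  by (simp add: slice_coeffs_def inj_slice_eval the_inv_f_f)

lemma star_prod_eval: "star_prod (slice_eval p) (slice_eval r) = slice_eval (p * r)"
  by (simp add: star_prod_def)

lemma star_monomial:
  "star_prod (\<lambda>q. ordered_monomial l q * a) (\<lambda>q. ordered_monomial m q * b) =
    (\<lambda>q. ordered_monomial (l + m) q * (a * b))"
  using star_prod_eval[of "Poly_Mapping.single l a" "Poly_Mapping.single m b"]
  by (simp add: slice_eval_single[abs_def] mult_single)

lemma star_add_left:
  assumes "P \<in> slice_polys" "Q \<in> slice_polys" "S \<in> slice_polys"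
  shows "star_prod (\<lambda>q. P q + Q q) S = (\<lambda>q. star_prod P S q + star_prod Q S q)"
  using assms
  by (auto simp: slice_polys_def star_prod_eval distrib_right
      simp flip: slice_eval_add intro!: ext)

lemma star_add_right:
  assumes "P \<in> slice_polys" "Q \<in> slice_polys" "S \<in> slice_polys"
  shows "star_prod S (\<lambda>q. P q + Q q) = (\<lambda>q. star_prod S P q + star_prod S Q q)"
  using assms
  by (auto simp: slice_polys_def star_prod_eval distrib_left
      simp flip: slice_eval_add intro!: ext)

lemma ring_slice_poly_ring: "ring slice_poly_ring"
proof -
  have add: "(\<lambda>q. slice_eval p q + slice_eval r q) = slice_eval (p + r)"
    for p r :: "('n::{finite,linorder} \<Rightarrow>\<^sub>0 nat) \<Rightarrow>\<^sub>0 quat"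
    by (simp add: slice_eval_add fun_eq_iff)
  have zero: "(\<lambda>q. 0) = slice_eval 0" and one: "(\<lambda>q. 1) = slice_eval 1"
    by (simp_all add: slice_eval_0 slice_eval_1 fun_eq_iff)
  note ring_defs = slice_poly_ring_def slice_polys_def add zero one star_prod_eval
  show ?thesis
  proof (rule ringI)
    show "abelian_group slice_poly_ring"
    proof (rule abelian_groupI)
      fix P :: "quat ^ 'n::{finite,linorder} \<Rightarrow> quat"
      assume "P \<in> carrier slice_poly_ring"
      then obtain p where "P = slice_eval p" by (auto simp: slice_poly_ring_def slice_polys_def)
      then show "\<exists>Q\<in>carrier slice_poly_ring. Q \<oplus>\<^bsub>slice_poly_ring\<^esub> P = \<zero>\<^bsub>slice_poly_ring\<^esub>"
        by (intro bexI[of _ "slice_eval (- p)"])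
          (simp_all add: slice_poly_ring_def slice_polys_def slice_eval_uminus)
    qed (auto simp: ring_defs ac_simps)
    show "monoid slice_poly_ring"
      by (rule monoidI) (auto simp: ring_defs mult.assoc)
  qed (auto simp: ring_defs algebra_simps)
qed

end

theory Submission
  imports Defs
begin

text \<open>On a sphere with \<open>x * x = t x - n\<close> every power is \<open>\<alpha> + x \<beta>\<close> with real \<open>\<alpha>, \<beta>\<close>, and the
  relation \<open>c + x d = 0\<close> at two points forces \<open>c = d = 0\<close>.  Real coefficients commute with
  everything, so the spherical variables can be eliminated one at a time from the left.  What
  remains are relations between the coefficients, which persist after multiplication from the
  left by a constant \<open>w\<close>, and any other solutions \<open>\<phi>\<close> of the recurrence
  \<open>\<phi> (j + 2) = t \<phi> (j + 1) - n \<phi> j\<close> can be put back in place of the powers.  Multiplying by a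
  monomial with exponents \<open>m\<close> amounts to the choice \<open>\<phi> j = x ^ (j + m)\<close> on the spheres, with \<open>w\<close>
  the value of the monomial at the remaining coordinates, which commute with each other.\<close>

lemma recurrence_basis:
  fixes t n :: real
  shows "\<exists>\<alpha> \<beta>. \<forall>\<phi> :: nat \<Rightarrow> 'a::real_vector.
    (\<forall>j. \<phi> (Suc (Suc j)) = t *\<^sub>R \<phi> (Suc j) - n *\<^sub>R \<phi> j) \<longrightarrow>
    (\<forall>j. \<phi> j = \<alpha> j *\<^sub>R \<phi> 0 + \<beta> j *\<^sub>R \<phi> (Suc 0))"
proof -
  \<comment> \<open>Here \<open>c\<close> is fixed before the solution, so one pair of coefficients
    serves every solution at index \<open>j\<close>.\<close>
  define comb :: "nat \<Rightarrow> real \<times> real \<Rightarrow> bool" where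
    "comb j c \<longleftrightarrow> (\<forall>\<phi> :: nat \<Rightarrow> 'a.
      (\<forall>j. \<phi> (Suc (Suc j)) = t *\<^sub>R \<phi> (Suc j) - n *\<^sub>R \<phi> j) \<longrightarrow>
      \<phi> j = fst c *\<^sub>R \<phi> 0 + snd c *\<^sub>R \<phi> (Suc 0))" for j c
  \<comment> \<open>The recurrence has order two, so the induction carries two consecutive
    indices.\<close>
  have "(\<exists>c. comb j c) \<and> (\<exists>c. comb (Suc j) c)" for j
  proof (induction j)
    case 0
    have "comb 0 (1, 0)" "comb (Suc 0) (0, 1)"
      by (simp_all add: comb_def)
    then show ?case by blast
  next
    case (Suc j)
    then obtain c d where cd: "comb j c" "comb (Suc j) d" by blast
    have "comb (Suc (Suc j)) (t * fst d - n * fst c, t * snd d - n * snd c)"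
      unfolding comb_def
    proof (intro allI impI)
      fix \<phi> :: "nat \<Rightarrow> 'a"
      assume rec: "\<forall>j. \<phi> (Suc (Suc j)) = t *\<^sub>R \<phi> (Suc j) - n *\<^sub>R \<phi> j"
      have c: "\<phi> j = fst c *\<^sub>R \<phi> 0 + snd c *\<^sub>R \<phi> (Suc 0)"
        using cd(1) rec unfolding comb_def by blast
      have d: "\<phi> (Suc j) = fst d *\<^sub>R \<phi> 0 + snd d *\<^sub>R \<phi> (Suc 0)"
        using cd(2) rec unfolding comb_def by blast
      have "\<phi> (Suc (Suc j)) = t *\<^sub>R \<phi> (Suc j) - n *\<^sub>R \<phi> j"
        using rec by blast
      then show "\<phi> (Suc (Suc j)) = fst (t * fst d - n * fst c, t * snd d - n * snd c) *\<^sub>R \<phi> 0 +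
          snd (t * fst d - n * fst c, t * snd d - n * snd c) *\<^sub>R \<phi> (Suc 0)"
        unfolding c d by (simp add: algebra_simps)
    qed
    with cd show ?case by blast
  qed
  then obtain c where c: "\<And>j. comb j (c j)" by metis
  show ?thesis
  proof (intro exI allI impI)
    fix \<phi> :: "nat \<Rightarrow> 'a" and j
    assume "\<forall>j. \<phi> (Suc (Suc j)) = t *\<^sub>R \<phi> (Suc j) - n *\<^sub>R \<phi> j"
    with c[of j] show "\<phi> j = fst (c j) *\<^sub>R \<phi> 0 + snd (c j) *\<^sub>R \<phi> (Suc 0)"
      unfolding comb_def by metis
  qed
qed

lemma power_recurrence:
  fixes x :: "'a::real_algebra_1"
  assumes "x * x = t *\<^sub>R x - n *\<^sub>R 1"
  shows "x ^ Suc (Suc j) = t *\<^sub>R x ^ Suc j - n *\<^sub>R x ^ j"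
proof -
  have "x ^ Suc (Suc j) = (x * x) * x ^ j" by (simp add: mult.assoc)
  then show ?thesis unfolding assms by (simp add: algebra_simps)
qed

text \<open>Induction on the list of spherical variables, with \<open>R\<close> arbitrary because
  eliminating the first variable rescales each \<open>R l\<close> by a real. At the empty list the
  relation is a vanishing sum of the \<open>R l\<close>, which survives left multiplication by
  \<open>w\<close>.\<close>

lemma sum_recurrent_eq_0:
  fixes S :: "'i \<Rightarrow> 'a::real_normed_div_algebra set" and e :: "'l \<Rightarrow> 'i \<Rightarrow> nat"
    and \<phi> :: "'i \<Rightarrow> nat \<Rightarrow> 'a"
  assumes "distinct is"
    and "\<And>i x. i \<in> set is \<Longrightarrow> x \<in> S i \<Longrightarrow> x * x = t i *\<^sub>R x - n i *\<^sub>R 1"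
    and "\<And>i. i \<in> set is \<Longrightarrow> \<exists>x\<in>S i. \<exists>y\<in>S i. x \<noteq> y"
    and "\<And>i j. i \<in> set is \<Longrightarrow> \<phi> i (Suc (Suc j)) = t i *\<^sub>R \<phi> i (Suc j) - n i *\<^sub>R \<phi> i j"
    and "\<And>q. (\<And>i. i \<in> set is \<Longrightarrow> q i \<in> S i) \<Longrightarrow>
      (\<Sum>l\<in>K. prod_list (map (\<lambda>i. q i ^ e l i) is) * R l) = 0"
  shows "(\<Sum>l\<in>K. prod_list (map (\<lambda>i. \<phi> i (e l i)) is) * w * R l) = 0"
  using assms
proof (induction "is" arbitrary: R)
  case Nil
  have "(\<Sum>l\<in>K. R l) = 0" using Nil.prems(5)[of undefined] by simp
  then show ?case by (simp flip: sum_distrib_left)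
next
  case (Cons i "is")
  obtain \<alpha> \<beta> where ab: "\<And>\<psi> :: nat \<Rightarrow> 'a. \<And>j.
      (\<And>j. \<psi> (Suc (Suc j)) = t i *\<^sub>R \<psi> (Suc j) - n i *\<^sub>R \<psi> j) \<Longrightarrow>
      \<psi> j = \<alpha> j *\<^sub>R \<psi> 0 + \<beta> j *\<^sub>R \<psi> (Suc 0)"
    using recurrence_basis[of "t i" "n i", where 'a = 'a] by blast
  \<comment> \<open>Being real, the weights pass through \<open>A l\<close> to \<open>R l\<close>.
    The two sums that remain no longer involve the chosen solution, so powers of a point and
    \<open>\<phi> i\<close> can be exchanged.\<close>
  have split: "(\<Sum>l\<in>K. \<psi> (e l i) * A l * R l) =
      \<psi> 0 * (\<Sum>l\<in>K. A l * (\<alpha> (e l i) *\<^sub>R R l)) + \<psi> (Suc 0) * (\<Sum>l\<in>K. A l * (\<beta> (e l i) *\<^sub>R R l))"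
    if "\<And>j. \<psi> (Suc (Suc j)) = t i *\<^sub>R \<psi> (Suc j) - n i *\<^sub>R \<psi> j"
    for \<psi> :: "nat \<Rightarrow> 'a" and A
  proof -
    have eq: "\<psi> j = \<alpha> j *\<^sub>R \<psi> 0 + \<beta> j *\<^sub>R \<psi> (Suc 0)" for j
      by (rule ab[of \<psi>, OF that])
    have "(\<Sum>l\<in>K. \<psi> (e l i) * A l * R l) =
        (\<Sum>l\<in>K. (\<alpha> (e l i) *\<^sub>R \<psi> 0 + \<beta> (e l i) *\<^sub>R \<psi> (Suc 0)) * A l * R l)"
      by (simp only: eq[symmetric])
    then show ?thesis
      by (simp add: sum_distrib_left sum.distrib distrib_right mult.assoc)
  qed
  have zero: "(\<Sum>l\<in>K. prod_list (map (\<lambda>i. q i ^ e l i) is) * (\<alpha> (e l i) *\<^sub>R R l)) = 0 \<and>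
      (\<Sum>l\<in>K. prod_list (map (\<lambda>i. q i ^ e l i) is) * (\<beta> (e l i) *\<^sub>R R l)) = 0"
    (is "?c = 0 \<and> ?d = 0") if q: "\<And>i. i \<in> set is \<Longrightarrow> q i \<in> S i" for q
  proof -
    have *: "?c + x * ?d = 0" if x: "x \<in> S i" for x
    proof -
      have "(\<Sum>l\<in>K. prod_list (map (\<lambda>j. (q(i := x)) j ^ e l j) (i # is)) * R l) = 0"
        by (rule Cons.prems(5)) (use q x in auto)
      \<comment> \<open>Since the list is distinct, updating \<open>q\<close> at \<open>i\<close>
        leaves the later factors unchanged.\<close>
      moreover have "map (\<lambda>j. (q(i := x)) j ^ e l j) is = map (\<lambda>j. q j ^ e l j) is" for l
        using Cons.prems(1) by auto
      ultimately have "(\<Sum>l\<in>K. x ^ e l i * prod_list (map (\<lambda>j. q j ^ e l j) is) * R l) = 0"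
        by (simp only: list.map prod_list.Cons fun_upd_same)
      then show ?thesis
        using split[of "\<lambda>j. x ^ j"] power_recurrence[OF Cons.prems(2)] x by auto
    qed
    obtain x y where xy: "x \<in> S i" "y \<in> S i" "x \<noteq> y"
      using Cons.prems(3)[of i] by auto
    \<comment> \<open>Subtracting the relation at two distinct points removes \<open>?c\<close>, and
      \<open>x - y\<close> is invertible.\<close>
    have "(x - y) * ?d = (?c + x * ?d) - (?c + y * ?d)" by (simp add: left_diff_distrib)
    also have "\<dots> = 0" using xy by (simp only: *) simp
    finally have "?d = 0" using xy by simp
    with *[OF xy(1)] show ?thesis by simp
  qed
  have IH: "(\<Sum>l\<in>K. prod_list (map (\<lambda>i. \<phi> i (e l i)) is) * w * R' l) = 0"
    if "\<And>q. (\<And>i. i \<in> set is \<Longrightarrow> q i \<in> S i) \<Longrightarrow>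
      (\<Sum>l\<in>K. prod_list (map (\<lambda>i. q i ^ e l i) is) * R' l) = 0" for R'
    by (rule Cons.IH) (use Cons.prems that in auto)
  \<comment> \<open>With \<open>w\<close> absorbed into \<open>A l\<close>, the induction hypothesis
    kills both sums produced by \<open>split\<close>.\<close>
  have "(\<Sum>l\<in>K. \<phi> i (e l i) * (prod_list (map (\<lambda>i. \<phi> i (e l i)) is) * w) * R l) = 0"
    using zero Cons.prems(4)[of i] by (subst split) (auto simp: IH simp del: mult_scaleR_right)
  then show ?case by (simp add: mult.assoc)
qed

section \<open>Geometry of the quaternionic spheres\<close>

lemma quat_of_real: "of_real r = Quat r 0 0 0"
  by (simp add: of_real_def one_quat_def scaleR_quat_def)

text \<open>All points of a sphere are roots of one real quadratic, with trace 2 Re(a) and norm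
  Re(a)^2 + |Im(a)|^2. This needs only J^2 = -1 and the centrality of the reals.\<close>

lemma quat_sphere_square:
  assumes "x \<in> quat_sphere a"
  shows "x * x = (2 * qRe a) *\<^sub>R x - ((qRe a)\<^sup>2 + (norm (a - of_real (qRe a)))\<^sup>2) *\<^sub>R 1"
proof -
  define s where "s = norm (a - of_real (qRe a))"
  obtain J where "x = of_real (qRe a) + J * of_real s" and J: "J * J = - 1"
    using assms by (auto simp: quat_sphere_def s_def)
  then have x: "x = qRe a *\<^sub>R 1 + s *\<^sub>R J"
    by (simp only: of_real_def mult_scaleR_right mult_1_right)
  \<comment> \<open>Only the left factor is expanded, so that \<open>s *\<^sub>R J\<close> can later
    be turned back into x - Re(a).\<close>
  have "x * x = qRe a *\<^sub>R x + s *\<^sub>R (J * x)"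
    by (subst (1) x) (simp add: distrib_right)
  also have "J * x = qRe a *\<^sub>R J - s *\<^sub>R 1"
    by (simp add: x distrib_left J)
  also have "s *\<^sub>R (qRe a *\<^sub>R J - s *\<^sub>R 1) = qRe a *\<^sub>R (x - qRe a *\<^sub>R 1) - s\<^sup>2 *\<^sub>R 1"
    by (simp add: x scaleR_diff_right power2_eq_square mult.commute)
  also have "qRe a *\<^sub>R x + \<dots> =
      (qRe a + qRe a) *\<^sub>R x - ((qRe a)\<^sup>2 + s\<^sup>2) *\<^sub>R 1"
    by (simp only: scaleR_add_left scaleR_diff_right scaleR_scaleR power2_eq_square
        add_diff_eq diff_diff_eq)
  finally show ?thesis by (simp only: mult_2 s_def)
qed

lemma quat_nonreal_norm:
  assumes "a \<notin> \<real>"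
  shows "norm (a - of_real (qRe a)) \<noteq> 0"
proof
  assume "norm (a - of_real (qRe a)) = 0"
  then have "a = of_real (qRe a)" by simp
  then show False using assms Reals_of_real by metis
qed

text \<open>The units i and j give different points because the radius |Im(a)| is nonzero.\<close>

lemma quat_sphere_two_points:
  assumes "a \<notin> \<real>"
  shows "\<exists>x\<in>quat_sphere a. \<exists>y\<in>quat_sphere a. x \<noteq> y"
proof -
  define s where "s = norm (a - of_real (qRe a))"
  define x where "x J = of_real (qRe a) + J * of_real s" for J :: quat
  have "x J \<in> quat_sphere a" if "J * J = - 1" for J
    using that by (auto simp: quat_sphere_def x_def s_def)
  then have "x (Quat 0 1 0 0) \<in> quat_sphere a" "x (Quat 0 0 1 0) \<in> quat_sphere a"
    by (simp_all add: times_quat_def one_quat_def uminus_quat_def)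
  moreover have "x (Quat 0 1 0 0) \<noteq> x (Quat 0 0 1 0)"
    using quat_nonreal_norm[OF assms, folded s_def]
    by (simp add: x_def quat_of_real times_quat_def plus_quat_def)
  ultimately show ?thesis by blast
qed

text \<open>The witness J is Im(a)/|Im(a)|: a purely imaginary b satisfies b^2 = -|b|^2.\<close>

lemma quat_in_sphere:
  assumes "a \<notin> \<real>"
  shows "a \<in> quat_sphere a"
proof -
  define s where "s = norm (a - of_real (qRe a))"
  have s: "s \<noteq> 0" using quat_nonreal_norm[OF assms] by (simp add: s_def)
  define b where "b = a - of_real (qRe a)"
  have b: "b * b = - ((s * s) *\<^sub>R 1)"
    by (simp add: b_def s_def quat_of_real norm_quat_def inner_quat_def quat_eq_iff
        times_quat_def one_quat_def quat_add_defs)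
  define J where "J = (1 / s) *\<^sub>R b"
  have "J * J = - 1" using s by (simp add: J_def b)
  moreover have "a = of_real (qRe a) + J * of_real s"
    using s by (simp add: J_def b_def of_real_def)
  ultimately show ?thesis unfolding quat_sphere_def s_def by blast
qed

section \<open>Expansion of products and additive structure of vanishing sets\<close>

lemma slice_eval_sum: "slice_eval (sum f A) q = (\<Sum>x\<in>A. slice_eval (f x) q)"
  by (induction A rule: infinite_finite_induct) (simp_all add: slice_eval_0 slice_eval_add)

lemma poly_mapping_sum_single:
  "(\<Sum>l\<in>Poly_Mapping.keys p. Poly_Mapping.single l (Poly_Mapping.lookup p l)) = p"
proof (rule poly_mapping_eqI)
  fix k
  have "(\<Sum>l\<in>Poly_Mapping.keys p. if l = k then Poly_Mapping.lookup p l else 0) =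
      Poly_Mapping.lookup p k"
    by (cases "k \<in> Poly_Mapping.keys p") (auto simp: not_in_keys_iff_lookup_eq_zero)
  then show "Poly_Mapping.lookup (\<Sum>l\<in>Poly_Mapping.keys p.
      Poly_Mapping.single l (Poly_Mapping.lookup p l)) k = Poly_Mapping.lookup p k"
    by (simp add: lookup_sum lookup_single when_def)
qed

text \<open>The monomials of \<open>r\<close> index the outer sum: for fixed \<open>m\<close> the
  coefficient of \<open>r\<close> stands last and factors out on the right.\<close>

lemma slice_eval_times:
  "slice_eval (p * r) q = (\<Sum>m\<in>Poly_Mapping.keys r. \<Sum>l\<in>Poly_Mapping.keys p.
    ordered_monomial (l + m) q * (Poly_Mapping.lookup p l * Poly_Mapping.lookup r m))"
proof -
  have "p * r = (\<Sum>m\<in>Poly_Mapping.keys r. \<Sum>l\<in>Poly_Mapping.keys p.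
      Poly_Mapping.single (l + m) (Poly_Mapping.lookup p l * Poly_Mapping.lookup r m))"
    by (subst (1) poly_mapping_sum_single[of p, symmetric],
        subst (1) poly_mapping_sum_single[of r, symmetric])
      (simp add: sum_distrib_left sum_distrib_right mult_single)
  then show ?thesis by (simp add: slice_eval_sum slice_eval_single)
qed

lemma additive_subgroup_vanishing_set: "additive_subgroup (vanishing_set U) slice_poly_ring"
proof (rule additive_subgroup.intro, rule subgroup.intro)
  interpret ring slice_poly_ring by (rule ring_slice_poly_ring)
  have 0: "(\<lambda>q. 0) \<in> slice_polys"
    using zero_closed by (simp add: slice_poly_ring_def)
  then show "\<one>\<^bsub>add_monoid slice_poly_ring\<^esub> \<in> vanishing_set U"
    by (simp add: vanishing_set_def slice_poly_ring_def)
  show "vanishing_set U \<subseteq> carrier (add_monoid slice_poly_ring)"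
    by (auto simp: vanishing_set_def slice_poly_ring_def)
  fix P assume P: "P \<in> vanishing_set U"
  then obtain p where p: "P = slice_eval p" by (auto simp: vanishing_set_def slice_polys_def)
  \<comment> \<open>Uniqueness of additive inverses identifies the abstract one with the evaluation
    of \<open>- p\<close>.\<close>
  have "\<ominus>\<^bsub>slice_poly_ring\<^esub> P = slice_eval (- p)"
    by (rule minus_equality)
      (auto simp: p slice_poly_ring_def slice_polys_def slice_eval_uminus)
  then show "inv\<^bsub>add_monoid slice_poly_ring\<^esub> P \<in> vanishing_set U"
    using P by (simp add: a_inv_def p vanishing_set_def slice_polys_def slice_eval_uminus)
  fix Q assume Q: "Q \<in> vanishing_set U"
  have "P \<oplus>\<^bsub>slice_poly_ring\<^esub> Q \<in> carrier slice_poly_ring"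
    using P Q by (intro a_closed) (auto simp: vanishing_set_def slice_poly_ring_def)
  then show "P \<otimes>\<^bsub>add_monoid slice_poly_ring\<^esub> Q \<in> vanishing_set U"
    using P Q by (simp add: vanishing_set_def slice_poly_ring_def)
qed

section \<open>Splitting monomials into spherical and commuting variables\<close>

lemma sorted_filter_append:
  fixes k :: "'a::linorder"
  assumes "sorted xs"
  shows "filter (\<lambda>x. x \<le> k) xs @ filter (\<lambda>x. k < x) xs = xs"
  using assms
proof (induction xs)
  case (Cons x xs)
  show ?case
  proof (cases "x \<le> k")
    case True
    then show ?thesis using Cons by simp
  next
    case False
    then have "filter (\<lambda>x. x \<le> k) xs = []" "filter (\<lambda>x. k < x) xs = xs"
      using Cons.prems by (auto simp: filter_empty_conv filter_id_conv)
    then show ?thesis using False by simp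
  qed
qed simp

lemma commute_prod_list:
  fixes y :: "'a::monoid_mult"
  assumes "\<And>x. x \<in> set xs \<Longrightarrow> y * x = x * y"
  shows "y * prod_list xs = prod_list xs * y"
  using assms
proof (induction xs)
  case (Cons x xs)
  have "y * (x * prod_list xs) = x * (y * prod_list xs)"
    using Cons.prems[of x] by (simp flip: mult.assoc)
  then show ?case using Cons by (simp add: mult.assoc)
qed simp

lemma prod_list_power_add:
  fixes f :: "'i \<Rightarrow> 'a::monoid_mult"
  assumes "\<And>i j. i \<in> set is \<Longrightarrow> j \<in> set is \<Longrightarrow> f i * f j = f j * f i"
  shows "prod_list (map (\<lambda>i. f i ^ (d i + e i)) is) =
    prod_list (map (\<lambda>i. f i ^ d i) is) * prod_list (map (\<lambda>i. f i ^ e i) is)"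
  using assms
proof (induction "is")
  case (Cons i "is")
  let ?D = "prod_list (map (\<lambda>i. f i ^ d i) is)" and ?E = "prod_list (map (\<lambda>i. f i ^ e i) is)"
  have "f i ^ e i * ?D = ?D * f i ^ e i"
    \<comment> \<open>This exchange is the only reordering needed to separate the two families of
      exponents.\<close>
    by (rule commute_prod_list)
      (use Cons.prems in \<open>auto intro!: power_commuting_commutes power_commuting_commutes[symmetric]\<close>)
  then have "f i ^ d i * (f i ^ e i * ?D) * ?E = f i ^ d i * (?D * f i ^ e i) * ?E"
    by simp
  then show ?case using Cons by (simp add: power_add mult.assoc)
qed simp

text \<open>The sum is the value at \<open>q\<close> of the product of \<open>p\<close> with the
  monomial of exponent \<open>m\<close> and coefficient 1.\<close>

lemma monomial_shift_vanishing:
  fixes a :: "quat ^ 'n::{finite,linorder}" and k :: 'n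
  defines "U \<equiv> {q. \<forall>l. q $ l \<in> (if l \<le> k then quat_sphere (a $ l) else {a $ l})}"
  assumes nonreal: "\<And>l. l \<le> k \<Longrightarrow> a $ l \<notin> \<real>"
    and comm: "\<And>l m. k < l \<Longrightarrow> k < m \<Longrightarrow> a $ l * a $ m = a $ m * a $ l"
    and van: "\<And>q. q \<in> U \<Longrightarrow> slice_eval p q = 0"
    and q: "q \<in> U"
  shows "(\<Sum>l\<in>Poly_Mapping.keys p. ordered_monomial (l + m) q * Poly_Mapping.lookup p l) = 0"
proof -
  define xs :: "'n list" where "xs = filter (\<lambda>i. i \<le> k) (sorted_list_of_set UNIV)"
  define ys :: "'n list" where "ys = filter (\<lambda>i. k < i) (sorted_list_of_set UNIV)"
  \<comment> \<open>The spherical variables come first in every ordered monomial, so they can be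
    eliminated from the left.\<close>
  have split: "sorted_list_of_set UNIV = xs @ ys"
    unfolding xs_def ys_def by (simp add: sorted_filter_append)
  have xs: "set xs = {i. i \<le> k}" "distinct xs" and ys: "set ys = {i. k < i}"
    by (auto simp: xs_def ys_def)
  let ?e = "Poly_Mapping.lookup :: ('n \<Rightarrow>\<^sub>0 nat) \<Rightarrow> 'n \<Rightarrow> nat"
  define T where "T l = prod_list (map (\<lambda>i. (a $ i) ^ ?e l i) ys)" for l
  \<comment> \<open>All points of \<open>U\<close> share the coordinates beyond \<open>k\<close>, so
    the tail \<open>T l\<close> is constant on \<open>U\<close>.\<close>
  have mono: "ordered_monomial l r = prod_list (map (\<lambda>i. (r $ i) ^ ?e l i) xs) * T l"
    if "r \<in> U" for l r
  proof -
    have "r $ i = a $ i" if "k < i" for i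
      using \<open>r \<in> U\<close> that unfolding U_def by (metis (mono_tags, lifting) mem_Collect_eq not_le singletonD)
    then have "map (\<lambda>i. (r $ i) ^ ?e l i) ys = map (\<lambda>i. (a $ i) ^ ?e l i) ys"
      using ys by simp
    then show ?thesis by (simp only: ordered_monomial_def split T_def map_append prod_list.append)
  qed
  \<comment> \<open>Commutativity lets \<open>T m\<close> come first, in the place of the constant
    \<open>w\<close>.\<close>
  have T: "T (l + m) = T m * T l" for l
    using prod_list_power_add[of ys "\<lambda>i. a $ i" "?e m" "?e l"] ys comm
    by (simp add: T_def lookup_add add.commute)
  have "(\<Sum>l\<in>Poly_Mapping.keys p. prod_list (map (\<lambda>i. (q $ i) ^ (?e l i + ?e m i)) xs) * T m *
      (T l * Poly_Mapping.lookup p l)) = 0"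
  proof (rule sum_recurrent_eq_0[where S = "\<lambda>i. quat_sphere (a $ i)"
        and \<phi> = "\<lambda>i j. (q $ i) ^ (j + ?e m i)" and t = "\<lambda>i. 2 * qRe (a $ i)"
        and n = "\<lambda>i. (qRe (a $ i))\<^sup>2 + (norm (a $ i - of_real (qRe (a $ i))))\<^sup>2"])
    show "distinct xs" by (rule xs(2))
    show "\<exists>x\<in>quat_sphere (a $ i). \<exists>y\<in>quat_sphere (a $ i). x \<noteq> y" if "i \<in> set xs" for i
      using that xs(1) nonreal quat_sphere_two_points by blast
    show "(q $ i) ^ (Suc (Suc j) + ?e m i) = (2 * qRe (a $ i)) *\<^sub>R (q $ i) ^ (Suc j + ?e m i) -
        ((qRe (a $ i))\<^sup>2 + (norm (a $ i - of_real (qRe (a $ i))))\<^sup>2) *\<^sub>R (q $ i) ^ (j + ?e m i)"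
      if "i \<in> set xs" for i j
    proof -
      have "q $ i \<in> quat_sphere (a $ i)"
        using q that xs(1) by (auto simp: U_def split: if_splits)
      from power_recurrence[OF quat_sphere_square[OF this], of "j + ?e m i"]
      show ?thesis by (simp only: add_Suc)
    qed
    fix r :: "'n \<Rightarrow> quat"
    assume r: "\<And>i. i \<in> set xs \<Longrightarrow> r i \<in> quat_sphere (a $ i)"
    \<comment> \<open>Completing \<open>r\<close> by the fixed coordinates gives a point of
      \<open>U\<close>, where \<open>p\<close> vanishes.\<close>
    define r' where "r' = (\<chi> i. if i \<le> k then r i else a $ i)"
    have r': "r' \<in> U" using r xs(1) by (auto simp: U_def r'_def)
    have "map (\<lambda>i. r i ^ ?e l i) xs = map (\<lambda>i. (r' $ i) ^ ?e l i) xs" for l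
      using xs(1) by (auto simp: r'_def)
    then show "(\<Sum>l\<in>Poly_Mapping.keys p. prod_list (map (\<lambda>i. r i ^ ?e l i) xs) *
        (T l * Poly_Mapping.lookup p l)) = 0"
      using van[OF r'] by (simp only: slice_eval_def mono[OF r'] mult.assoc)
  qed (rule quat_sphere_square)
  then show ?thesis
    by (simp add: mono[OF q] T lookup_add mult.assoc)
qed

theorem proposition3p7:
  fixes a :: "quat ^ 'n::{finite,linorder}" and k :: 'n
  assumes "\<And>l. l \<le> k \<Longrightarrow> a $ l \<notin> \<real>"
    and "\<And>l m. k < l \<Longrightarrow> k < m \<Longrightarrow> a $ l * a $ m = a $ m * a $ l"
  shows "right_ideal
      (vanishing_set {q. \<forall>l. q $ l \<in> (if l \<le> k then quat_sphere (a $ l) else {a $ l})})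
      slice_poly_ring \<and>
    vanishing_set {q. \<forall>l. q $ l \<in> (if l \<le> k then quat_sphere (a $ l) else {a $ l})}
      \<subseteq> vanishing_set {a}"
proof -
  let ?U = "{q. \<forall>l. q $ l \<in> (if l \<le> k then quat_sphere (a $ l) else {a $ l})}"
  have "a \<in> ?U"
    using assms(1) quat_in_sphere by auto
  then have "vanishing_set ?U \<subseteq> vanishing_set {a}"
    unfolding vanishing_set_def by blast
  moreover have "right_ideal (vanishing_set ?U) slice_poly_ring"
  proof (intro right_ideal.intro right_ideal_axioms.intro ring_slice_poly_ring)
    show "additive_subgroup (vanishing_set ?U) slice_poly_ring"
      by (rule additive_subgroup_vanishing_set)
    fix P Q :: "quat ^ 'n::{finite,linorder} \<Rightarrow> quat"
    assume P: "P \<in> vanishing_set ?U" and "Q \<in> carrier slice_poly_ring"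
    then obtain p r where p: "P = slice_eval p" and r: "Q = slice_eval r"
      by (auto simp: vanishing_set_def slice_polys_def slice_poly_ring_def)
    have "slice_eval (p * r) q = 0" if "q \<in> ?U" for q
    proof -
      \<comment> \<open>Each monomial of \<open>Q\<close> is treated separately; its coefficient
        then multiplies a zero sum from the right.\<close>
      have "(\<Sum>l\<in>Poly_Mapping.keys p. ordered_monomial (l + m) q * Poly_Mapping.lookup p l) = 0" for m
        using P that
        by (intro monomial_shift_vanishing[OF assms]) (auto simp: p vanishing_set_def)
      then show ?thesis
        by (simp add: slice_eval_times flip: mult.assoc sum_distrib_right)
    qed
    then show "P \<otimes>\<^bsub>slice_poly_ring\<^esub> Q \<in> vanishing_set ?U"
      by (simp add: slice_poly_ring_def p r star_prod_eval vanishing_set_def slice_polys_def)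
  qed
  ultimately show ?thesis by blast
qed

end
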